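(* Let $N\ge1$, $0<s<1$, $1<p<\infty$ with $s\,p>N$, and let $u\in \mathcal{W}^{s,p}(\mathbb{R}^N)$ be an extremal for $\mathfrak{m}_{s,p}(\mathbb{R}^N)$. Let $x_0,y_0\in\mathbb{R}^N$ be the (unique) two distinct points such that \[ [u]_{C^{0,\alpha_{s,p}}(\mathbb{R}^N)}=\frac{|u(x_0)-u(y_0)|}{|x_0-y_0|^{\alpha_{s,p}}}. \] Then $u\in L^\infty(\mathbb{R}^N)$ and \[ \min\{u(x_0),u(y_0)\}\le u(x)\le \max\{u(x_0),u(y_0)\},\qquad \mbox{ for every }x\in\mathbb{R}^N. \]
   Context: $[\varphi]_{W^{s,p}(\mathbb{R}^N)}=\left(\iint_{\mathbb{R}^N\times\mathbb{R}^N}\frac{|\varphi(x)-\varphi(y)|^p}{|x-y|^{N+s\,p}}dx\,dy\right)^{1/p}$; $[\varphi]_{C^{0,\alpha}(\mathbb{R}^N)}=\sup_{x\ne y}\frac{|\varphi(x)-\varphi(y)|}{|x-y|^\alpha}$; $\alpha_{s,p}=s-N/p$. $\mathcal{W}^{s,p}(\mathbb{R}^N)$ is the set of continuous functions with finite $[\cdot]_{C^{0,\alpha_{s,p}}(\mathbb{R}^N)}$ and finite $[\cdot]_{W^{s,p}(\mathbb{R}^N)}$. $\mathfrak{m}_{s,p}(\mathbb{R}^N)=\inf\{[\varphi]^p_{W^{s,p}(\mathbb{R}^N)}:\varphi\in C^\infty_0(\mathbb{R}^N),\ [\varphi]_{C^{0,\alpha_{s,p}}(\mathbb{R}^N)}=1\}$.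 An extremal for $\mathfrak{m}_{s,p}(\mathbb{R}^N)$ is a non-constant $u\in\mathcal{W}^{s,p}(\mathbb{R}^N)$ with $[u]^p_{W^{s,p}(\mathbb{R}^N)}=\mathfrak{m}_{s,p}(\mathbb{R}^N)[u]^p_{C^{0,\alpha_{s,p}}(\mathbb{R}^N)}$. *)

theory Defs
  imports "HOL-Analysis.Analysis"
begin

fun dir_derivs :: "'a::euclidean_space list \<Rightarrow> ('a \<Rightarrow> real) \<Rightarrow> ('a \<Rightarrow> real)" where
  "dir_derivs [] f = f"
| "dir_derivs (v # vs) f = (\<lambda>x. frechet_derivative (dir_derivs vs f) (at x) v)"

definition smooth :: "('a::euclidean_space \<Rightarrow> real) \<Rightarrow> bool" where
  "smooth f \<longleftrightarrow> (\<forall>vs. set vs \<subseteq> Basis \<longrightarrow> (\<forall>x. dir_derivs vs f differentiable (at x)))"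

definition Cinf0 :: "('a::euclidean_space \<Rightarrow> real) set" where
  "Cinf0 = {f. smooth f \<and> compact (closure {x. f x \<noteq> 0})}"

definition gagliardo_pow :: "real \<Rightarrow> real \<Rightarrow> ('a::euclidean_space \<Rightarrow> real) \<Rightarrow> ennreal" where
  "gagliardo_pow s p \<phi> =
     (\<integral>\<^sup>+ z. ennreal (\<bar>\<phi> (fst z) - \<phi> (snd z)\<bar> powr p
                     / norm (fst z - snd z) powr (real DIM('a) + s * p)) \<partial>(lborel \<Otimes>\<^sub>M lborel))"

definition holder_quots :: "real \<Rightarrow> ('a::real_normed_vector \<Rightarrow> real) \<Rightarrow> real set" where
  "holder_quots \<alpha> \<phi> = {\<bar>\<phi> x - \<phi> y\<bar> / norm (x - y) powr \<alpha> | x y. x \<noteq> y}"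

text \<open>Hoelder seminorm (meaningful when holder_quots is bounded above).\<close>
definition holder_seminorm :: "real \<Rightarrow> ('a::real_normed_vector \<Rightarrow> real) \<Rightarrow> real" where
  "holder_seminorm \<alpha> \<phi> = Sup (holder_quots \<alpha> \<phi>)"

definition alpha_sp :: "real \<Rightarrow> real \<Rightarrow> nat \<Rightarrow> real" where
  "alpha_sp s p N = s - real N / p"

definition Wsp :: "real \<Rightarrow> real \<Rightarrow> ('a::euclidean_space \<Rightarrow> real) set" where
  "Wsp s p = {u. continuous_on UNIV u
                 \<and> bdd_above (holder_quots (alpha_sp s p DIM('a)) u)
                 \<and> gagliardo_pow s p u < \<infinity>}"

definition msp :: "real \<Rightarrow> real \<Rightarrow> 'a::euclidean_space itself \<Rightarrow> ennreal" where
  "msp s p _ = (INF \<phi> \<in> {\<phi> :: 'a \<Rightarrow> real. \<phi> \<in> Cinf0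
                     \<and> bdd_above (holder_quots (alpha_sp s p DIM('a)) \<phi>)
                     \<and> holder_seminorm (alpha_sp s p DIM('a)) \<phi> = 1}. gagliardo_pow s p \<phi>)"

definition extremal :: "real \<Rightarrow> real \<Rightarrow> ('a::euclidean_space \<Rightarrow> real) \<Rightarrow> bool" where
  "extremal s p u \<longleftrightarrow> u \<in> Wsp s p \<and> (\<exists>x y. u x \<noteq> u y)
     \<and> gagliardo_pow s p u
         = msp s p TYPE('a) * ennreal (holder_seminorm (alpha_sp s p DIM('a)) u powr p)"

end

theory Submission
  imports Defs
begin

text \<open>
  Truncate \<open>u\<close> at the two values \<open>u x0\<close> and \<open>u y0\<close>. The truncation \<open>v\<close> has pointwise smaller
  differences but the same Hoelder quotient at the pair \<open>(x0, y0)\<close>, so by minimality it has the same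
  Gagliardo energy as \<open>u\<close>; hence \<open>\<bar>v x - v y\<bar> = \<bar>u x - u y\<bar>\<close> for all \<open>x\<close> and \<open>y\<close>, which fails if
  \<open>u\<close> leaves the interval between \<open>u x0\<close> and \<open>u y0\<close>.

  Minimality is only given among compactly supported smooth functions, so the bounded function \<open>v\<close> has
  to be approximated by such functions in energy and at the two points \<open>x0\<close>, \<open>y0\<close>. As the extremal
  \<open>u\<close> has finite energy, the infimum is finite and there is a nonzero test function of finite energy:
  its dilates serve as cut-offs, and the normalised squares of its contractions as mollifiers.
\<close>

section \<open>Convexity of the power function\<close>

text \<open>A convex power lies above its tangents. The end points are treated apart because
  convexity is applied on the open half-line: for \<open>c = 0\<close> the left side is
  \<open>0\<close>, for \<open>a = 0\<close> it is \<open>(1 - p) * c powr p\<close>, which is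
  nonpositive.\<close>

lemma powr_above_tangent:
  fixes a c p :: real
  assumes "1 < p" "0 \<le> a" "0 \<le> c"
  shows "c powr p + p * c powr (p - 1) * (a - c) \<le> a powr p"
proof -
  consider "c = 0" | "c > 0" "a = 0" | "c > 0" "a > 0" using assms by linarith
  then show ?thesis
  proof cases
    case 1
    then show ?thesis using assms by simp
  next
    case 2
    have "c powr p = c powr (p - 1) * c" using 2 by (simp add: powr_diff)
    then have "c powr p + p * c powr (p - 1) * (a - c) = (1 - p) * c powr p"
      using 2 by (simp add: algebra_simps)
    also have "\<dots> \<le> 0" using assms by (simp add: mult_nonpos_nonneg)
    finally show ?thesis using 2 assms by simp
  next
    case 3
    have "p * c powr (p - 1) * (a - c) \<le> a powr p - c powr p"
    proof (rule convex_on_imp_above_tangent[where A = "{0<..}"])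
      show "convex_on {0<..} (\<lambda>x. x powr p)" using assms by (intro powr_convex) auto
      show "connected {0::real<..}" by simp
      show "c \<in> interior {0<..}" using 3 by (simp add: interior_open)
      show "a \<in> {0<..}" using 3 by simp
      show "((\<lambda>x. x powr p) has_field_derivative p * c powr (p - 1)) (at c within {0<..})"
        using 3 by (auto intro!: derivative_eq_intros)
    qed
    then show ?thesis by linarith
  qed
qed

text \<open>Jensen's inequality for \<open>a + b = (1 - t) * (a / (1 - t)) + t * (b / t)\<close>.
  For small \<open>t\<close> the factor of \<open>a powr p\<close> is close to one; the large factor
  of \<open>b powr p\<close> is affordable when \<open>b\<close> stands for a term of small
  energy.\<close>

lemma powr_add_weighted:
  fixes a b p t :: real
  assumes "1 < p" "0 \<le> a" "0 \<le> b" "0 < t" "t < 1"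
  shows "(a + b) powr p \<le> (1 - t) powr (1 - p) * a powr p + t powr (1 - p) * b powr p"
proof -
  let ?c = "a + b"
  let ?T = "\<lambda>x. ?c powr p + p * ?c powr (p - 1) * (x - ?c)"
  have weight: "r * (x / r) powr p = r powr (1 - p) * x powr p" if "r > 0" "x \<ge> 0" for r x :: real
    using that by (simp add: powr_divide powr_diff field_simps)
  \<comment> \<open>The tangent at \<open>a + b\<close> is evaluated at two points whose weighted
    mean is \<open>a + b\<close>, so the linear terms cancel.\<close>
  have "?c powr p = (1 - t) * ?T (a / (1 - t)) + t * ?T (b / t)"
  proof -
    have "(1 - t) * (a / (1 - t) - ?c) + t * (b / t - ?c) = 0"
      using assms by (simp add: field_simps)
    moreover have "(1 - t) * (K + q * x) + t * (K + q * y) = K + q * ((1 - t) * x + t * y)"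
      for K q x y :: real by (simp add: algebra_simps)
    ultimately show ?thesis by simp
  qed
  also have "\<dots> \<le> (1 - t) * (a / (1 - t)) powr p + t * (b / t) powr p"
    using assms by (intro add_mono mult_left_mono powr_above_tangent) auto
  finally show ?thesis using assms by (simp add: weight)
qed

text \<open>The tangent inequality at the mean \<open>?A\<close> of the absolute values is
  integrated against \<open>k\<close>; since \<open>k\<close> has mass one, the linear term
  integrates to zero.\<close>

lemma jensen_powr:
  fixes g k :: "'a \<Rightarrow> real"
  assumes p: "1 < p" and k: "\<And>x. 0 \<le> k x"
    and int: "integrable M k" "integral\<^sup>L M k = 1"
      "integrable M (\<lambda>x. g x * k x)" "integrable M (\<lambda>x. \<bar>g x\<bar> powr p * k x)"
  shows "\<bar>\<integral>x. g x * k x \<partial>M\<bar> powr p \<le> (\<integral>x. \<bar>g x\<bar> powr p * k x \<partial>M)"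
proof -
  let ?A = "\<integral>x. \<bar>g x\<bar> * k x \<partial>M"
  have abs_int: "integrable M (\<lambda>x. \<bar>g x\<bar> * k x)"
    using integrable_abs[OF int(3)] k by (simp add: abs_mult)
  have A: "0 \<le> ?A" using k by (intro integral_nonneg_AE) auto
  have "\<bar>\<integral>x. g x * k x \<partial>M\<bar> \<le> (\<integral>x. \<bar>g x * k x\<bar> \<partial>M)" by (rule integral_abs_bound)
  also have "\<dots> = ?A" using k by (simp add: abs_mult)
  finally have "\<bar>\<integral>x. g x * k x \<partial>M\<bar> powr p \<le> ?A powr p"
    using p by (intro powr_mono2) auto
  also have "?A powr p
      = (\<integral>x. (?A powr p - p * ?A powr (p - 1) * ?A) * k x + p * ?A powr (p - 1) * (\<bar>g x\<bar> * k x) \<partial>M)"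
    using int(1,2) abs_int by simp
  also have "\<dots> \<le> (\<integral>x. \<bar>g x\<bar> powr p * k x \<partial>M)"
  proof (rule integral_mono)
    show "integrable M (\<lambda>x. (?A powr p - p * ?A powr (p - 1) * ?A) * k x
        + p * ?A powr (p - 1) * (\<bar>g x\<bar> * k x))"
      using int(1) abs_int by simp
    show "integrable M (\<lambda>x. \<bar>g x\<bar> powr p * k x)" by (rule int(4))
    fix x
    have "(?A powr p + p * ?A powr (p - 1) * (\<bar>g x\<bar> - ?A)) * k x \<le> \<bar>g x\<bar> powr p * k x"
      using p A k by (intro mult_right_mono powr_above_tangent) auto
    then show "(?A powr p - p * ?A powr (p - 1) * ?A) * k x + p * ?A powr (p - 1) * (\<bar>g x\<bar> * k x)
        \<le> \<bar>g x\<bar> powr p * k x"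
      by (simp add: algebra_simps)
  qed
  finally show ?thesis .
qed

section \<open>Calculus of smooth functions\<close>

lemma smooth_dir_derivs_differentiable:
  "smooth f \<Longrightarrow> set vs \<subseteq> Basis \<Longrightarrow> dir_derivs vs f differentiable (at x)"
  by (simp add: smooth_def)

lemma smooth_differentiable: "smooth f \<Longrightarrow> f differentiable (at x)"
  using smooth_dir_derivs_differentiable[of f "[]"] by simp

lemma smooth_continuous_on: "smooth f \<Longrightarrow> continuous_on S f"
  by (meson continuous_at_imp_continuous_on differentiable_imp_continuous_within smooth_differentiable)

lemma dir_derivs_append: "dir_derivs (vs @ ws) f = dir_derivs vs (dir_derivs ws f)"
  by (induction vs) simp_all

lemma smooth_dir_derivs:
  assumes "smooth f" "set ws \<subseteq> Basis"
  shows "smooth (dir_derivs ws f)"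
  using assms unfolding smooth_def by (auto simp flip: dir_derivs_append)

lemma smooth_frechet_derivative:
  "smooth f \<Longrightarrow> b \<in> Basis \<Longrightarrow> smooth (\<lambda>x. frechet_derivative f (at x) b)"
  using smooth_dir_derivs[of f "[b]"] by simp

lemma smooth_has_derivative: "smooth f \<Longrightarrow> (f has_derivative frechet_derivative f (at x)) (at x)"
  using smooth_differentiable frechet_derivative_works by blast

text \<open>By the chain rule each derivative contributes a factor \<open>r\<close> and leaves the
  shape unchanged, which is why a general constant in front is carried along.\<close>

lemma smooth_scale_affine:
  fixes f :: "'a::euclidean_space \<Rightarrow> real"
  assumes f: "smooth f"
  shows "smooth (\<lambda>x. c * f (a + r *\<^sub>R x))"
proof -
  have deriv: "((\<lambda>x. K * g (a + r *\<^sub>R x)) has_derivative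
      (\<lambda>h. K * frechet_derivative g (at (a + r *\<^sub>R x)) (r *\<^sub>R h))) (at x)"
    if "smooth g" for g :: "'a \<Rightarrow> real" and K x
  proof -
    have "((\<lambda>x. a + r *\<^sub>R x) has_derivative (\<lambda>h. r *\<^sub>R h)) (at x)"
      by (auto intro!: derivative_eq_intros)
    from diff_chain_at[OF this smooth_has_derivative[OF that]]
    show ?thesis by (auto intro!: derivative_eq_intros simp: o_def)
  qed
  have "dir_derivs vs (\<lambda>x. c * f (a + r *\<^sub>R x))
      = (\<lambda>x. (c * r ^ length vs) * dir_derivs vs f (a + r *\<^sub>R x))" if "set vs \<subseteq> Basis" for vs
    using that
  proof (induction vs)
    case (Cons v vs)
    let ?g = "dir_derivs vs f"
    have g: "smooth ?g" using smooth_dir_derivs[OF f] Cons by simp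
    show ?case
    proof
      fix x
      have "linear (frechet_derivative ?g (at (a + r *\<^sub>R x)))"
        using smooth_has_derivative[OF g] has_derivative_linear by blast
      then show "dir_derivs (v # vs) (\<lambda>x. c * f (a + r *\<^sub>R x)) x
          = (c * r ^ length (v # vs)) * dir_derivs (v # vs) f (a + r *\<^sub>R x)"
        using Cons frechet_derivative_at[OF deriv[OF g, of "c * r ^ length vs" x], symmetric]
        by (simp add: linear_scale)
    qed
  qed simp
  moreover have "(\<lambda>x. K * dir_derivs vs f (a + r *\<^sub>R x)) differentiable (at x)"
    if "set vs \<subseteq> Basis" for vs K x
    using deriv[OF smooth_dir_derivs[OF f that]] unfolding differentiable_def by blast
  ultimately show ?thesis unfolding smooth_def by (intro allI impI) (simp only:)
qed

text \<open>A class closed under partial differentiation that contains the product of two smooth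
  functions. All iterated derivatives of a product stay in it, so no explicit Leibniz formula has to
  be written.\<close>

inductive sum_of_smooth_products :: "('a::euclidean_space \<Rightarrow> real) \<Rightarrow> bool" where
  prod: "smooth f \<Longrightarrow> smooth g \<Longrightarrow> sum_of_smooth_products (\<lambda>x. f x * g x)"
| add: "sum_of_smooth_products f \<Longrightarrow> sum_of_smooth_products g \<Longrightarrow>
    sum_of_smooth_products (\<lambda>x. f x + g x)"

lemma sum_of_smooth_products_derivative:
  assumes "sum_of_smooth_products f"
  shows "(\<forall>x. f differentiable (at x)) \<and>
    (\<forall>b\<in>Basis. sum_of_smooth_products (\<lambda>x. frechet_derivative f (at x) b))"
  using assms
proof induction
  case (prod f g)
  have deriv: "((\<lambda>x. f x * g x) has_derivative
      (\<lambda>h. f x * frechet_derivative g (at x) h + frechet_derivative f (at x) h * g x)) (at x)" for x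
    by (rule has_derivative_mult[OF smooth_has_derivative smooth_has_derivative]) fact+
  then have "sum_of_smooth_products (\<lambda>x. frechet_derivative (\<lambda>x. f x * g x) (at x) b)"
    if "b \<in> Basis" for b
    unfolding frechet_derivative_at[OF deriv, symmetric] using that prod
    by (intro sum_of_smooth_products.intros smooth_frechet_derivative)
  with deriv show ?case unfolding differentiable_def by blast
next
  case (add f g)
  have deriv: "((\<lambda>x. f x + g x) has_derivative
      (\<lambda>h. frechet_derivative f (at x) h + frechet_derivative g (at x) h)) (at x)" for x
    using add by (intro has_derivative_add) (auto simp flip: frechet_derivative_works)
  then have "sum_of_smooth_products (\<lambda>x. frechet_derivative (\<lambda>x. f x + g x) (at x) b)"
    if "b \<in> Basis" for b
    unfolding frechet_derivative_at[OF deriv, symmetric] using that add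
    by (intro sum_of_smooth_products.add) auto
  with deriv show ?case unfolding differentiable_def by blast
qed

lemma smooth_mult:
  assumes "smooth f" "smooth g"
  shows "smooth (\<lambda>x. f x * g x)"
proof -
  have "sum_of_smooth_products (dir_derivs vs (\<lambda>x. f x * g x))" if "set vs \<subseteq> Basis" for vs
    using that
  proof (induction vs)
    case Nil
    then show ?case using assms by (simp add: sum_of_smooth_products.prod)
  next
    case (Cons v vs)
    then show ?case using sum_of_smooth_products_derivative by auto
  qed
  then show ?thesis using sum_of_smooth_products_derivative by (auto simp: smooth_def)
qed

text \<open>Differentiation under the integral sign puts all derivatives on \<open>k\<close>, so
  continuity of \<open>w\<close> suffices. The box keeps the domain of integration compact.\<close>

lemma smooth_convolution:
  fixes k w :: "'a::euclidean_space \<Rightarrow> real"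
  assumes k: "smooth k" and w: "continuous_on UNIV w"
  shows "smooth (\<lambda>x. integral (cbox a b) (\<lambda>t. w t * k (x - t)))"
proof -
  have cont: "continuous_on S (\<lambda>x. f (h x))" if "smooth f" "continuous_on S h"
    for S :: "'b::topological_space set" and f :: "'a \<Rightarrow> real" and h
    using continuous_on_compose2[OF smooth_continuous_on[OF that(1)] that(2), of UNIV] by simp
  have contw: "continuous_on S (\<lambda>x. w (h x))" if "continuous_on S h"
    for S :: "'b::topological_space set" and h
    using continuous_on_compose2[OF w that] by simp
  have deriv: "((\<lambda>x. integral (cbox a b) (\<lambda>t. w t * f (x - t))) has_derivative
      (\<lambda>h. integral (cbox a b) (\<lambda>t. w t * frechet_derivative f (at (x - t)) h))) (at x)"
    (is "(_ has_derivative ?D) _") if f: "smooth f" for f :: "'a \<Rightarrow> real" and x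
  proof -
    let ?d = "\<lambda>y i. frechet_derivative f (at y) i"
    \<comment> \<open>The derivative as a bounded linear map, expanded in the basis: its
      coefficients are partial derivatives of \<open>f\<close>, which makes the continuity in
      \<open>(x, t)\<close> evident.\<close>
    let ?F = "\<lambda>x t. w t *\<^sub>R (\<Sum>i\<in>Basis. ?d (x - t) i *\<^sub>R blinfun_inner_right i)"
    have F: "blinfun_apply (?F x t) = (\<lambda>h. w t * ?d (x - t) h)" for x t
    proof
      fix h
      have "?d (x - t) h = ?d (x - t) (\<Sum>i\<in>Basis. (h \<bullet> i) *\<^sub>R i)"
        by (simp only: euclidean_representation)
      also have "\<dots> = (\<Sum>i\<in>Basis. ?d (x - t) i * (i \<bullet> h))"
        using has_derivative_linear[OF smooth_has_derivative[OF f], of "x - t"]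
        by (simp add: linear_sum linear_scale inner_commute mult.commute)
      finally show "blinfun_apply (?F x t) h = w t * ?d (x - t) h"
        by (simp add: blinfun.scaleR_left blinfun.sum_left)
    qed
    have contF: "continuous_on (UNIV \<times> cbox a b) (\<lambda>(x, t). ?F x t)"
      unfolding case_prod_unfold
      by (intro continuous_intros contw cont smooth_frechet_derivative[OF f])
    have "((\<lambda>x. integral (cbox a b) (\<lambda>t. w t * f (x - t))) has_derivative
        integral (cbox a b) (?F x)) (at x)"
    proof (rule leibniz_rule[where U = UNIV, OF _ _ contF])
      fix x t :: 'a
      have "((\<lambda>x. x - t) has_derivative (\<lambda>h. h)) (at x)"
        by (auto intro!: derivative_eq_intros)
      from diff_chain_at[OF this smooth_has_derivative[OF f]]
      show "((\<lambda>x. w t * f (x - t)) has_derivative ?F x t) (at x)"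
        unfolding F by (auto intro!: derivative_eq_intros simp: o_def)
    qed (auto intro!: integrable_continuous contw cont[OF f] continuous_intros)
    \<comment> \<open>Evaluation at \<open>h\<close> is moved inside the operator-valued
      integral.\<close>
    moreover have "blinfun_apply (integral (cbox a b) (?F x)) = ?D"
    proof
      fix h
      have "?F x integrable_on cbox a b"
        by (intro integrable_continuous continuous_intros contw cont smooth_frechet_derivative[OF f])
      then show "blinfun_apply (integral (cbox a b) (?F x)) h = ?D h"
        by (simp only: blinfun_apply_integral F)
    qed
    ultimately show ?thesis by simp
  qed
  have "dir_derivs vs (\<lambda>x. integral (cbox a b) (\<lambda>t. w t * k (x - t)))
      = (\<lambda>x. integral (cbox a b) (\<lambda>t. w t * dir_derivs vs k (x - t)))" if "set vs \<subseteq> Basis" for vs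
    using that
  proof (induction vs)
    case (Cons v vs)
    have "smooth (dir_derivs vs k)" using smooth_dir_derivs[OF k] Cons by simp
    from frechet_derivative_at[OF deriv[OF this], symmetric] show ?case using Cons by simp
  qed simp
  moreover have "(\<lambda>x. integral (cbox a b) (\<lambda>t. w t * dir_derivs vs k (x - t))) differentiable (at x)"
    if "set vs \<subseteq> Basis" for vs x
    using deriv[OF smooth_dir_derivs[OF k that]] unfolding differentiable_def by blast
  ultimately show ?thesis unfolding smooth_def by (intro allI impI) (simp only:)
qed

section \<open>Integration, and the Gagliardo energy under scaling and convolution\<close>

lemma integrable_continuous_compact_support:
  fixes f :: "'a::euclidean_space \<Rightarrow> real"
  assumes "continuous_on UNIV f" "compact K" "\<And>x. x \<notin> K \<Longrightarrow> f x = 0"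
  shows "integrable lborel f"
proof -
  have "integrable lborel (\<lambda>x. indicator K x *\<^sub>R f x)"
    using assms by (intro borel_integrable_compact continuous_on_subset[OF assms(1)]) auto
  also have "(\<lambda>x. indicator K x *\<^sub>R f x) = f" using assms(3) by (fastforce simp: indicator_def)
  finally show ?thesis .
qed

lemma integral_reflect_translate:
  fixes f :: "'a::euclidean_space \<Rightarrow> real"
  assumes [measurable]: "f \<in> borel_measurable borel"
  shows "(\<integral>y. f y \<partial>lborel) = (\<integral>z. f (x - z) \<partial>lborel)"
proof -
  have "lborel = distr lborel borel (\<lambda>z. x - z)"
    using lborel_affine[of "-1" x] by (simp add: density_1)
  then have "(\<integral>y. f y \<partial>lborel) = (\<integral>y. f y \<partial>distr lborel borel (\<lambda>z. x - z))" by simp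
  also have "\<dots> = (\<integral>z. f (x - z) \<partial>lborel)" by (rule integral_distr) simp_all
  finally show ?thesis .
qed

lemma gagliardo_integrand_measurable:
  fixes f :: "'a::euclidean_space \<Rightarrow> real"
  assumes [measurable]: "f \<in> borel_measurable borel"
  shows "(\<lambda>z. \<bar>f (fst z) - f (snd z)\<bar> powr p / norm (fst z - snd z) powr q)
    \<in> borel_measurable (lborel \<Otimes>\<^sub>M lborel)"
  by measurable

text \<open>With \<open>N\<close> the dimension, the change of variables in both arguments gives
  \<open>R powr (2 * N)\<close> and the kernel takes away \<open>R powr (N + s * p)\<close>. For
  \<open>s * p > N\<close> the energy of a dilate tends to zero as \<open>R\<close> grows;
  \<open>R = 1\<close> is translation invariance.\<close>

lemma gagliardo_pow_affine:
  fixes f :: "'a::euclidean_space \<Rightarrow> real"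
  assumes f: "continuous_on UNIV f" and R: "0 < R"
  shows "gagliardo_pow s p (\<lambda>x. f (a + (1 / R) *\<^sub>R x))
    = ennreal (R powr (real DIM('a) - s * p)) * gagliardo_pow s p f"
proof -
  let ?q = "real DIM('a) + s * p"
  let ?I = "\<lambda>g z. ennreal (\<bar>g (fst z) - g (snd z)\<bar> powr p / norm (fst z - snd z) powr ?q)"
  let ?f = "\<lambda>x. f (a + (1 / R) *\<^sub>R x)"
  let ?t = "((- R) *\<^sub>R a, (- R) *\<^sub>R a)"
  have [measurable]: "f \<in> borel_measurable borel"
    using f by (rule borel_measurable_continuous_onI)
  have I: "(\<lambda>z. \<bar>g (fst z) - g (snd z)\<bar> powr p / norm (fst z - snd z) powr ?q)
      \<in> borel_measurable borel" if "g \<in> borel_measurable borel" for g :: "'a \<Rightarrow> real"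
    using gagliardo_integrand_measurable[OF that] by (simp add: lborel_prod)
  note [measurable] = I[of f] I[of ?f]
  have "gagliardo_pow s p ?f = (\<integral>\<^sup>+ z. ?I ?f z \<partial>lborel)"
    by (simp add: gagliardo_pow_def lborel_prod)
  also have "\<dots> = (\<integral>\<^sup>+ z. ?I ?f z \<partial>density (distr lborel borel (\<lambda>z. ?t + R *\<^sub>R z))
      (\<lambda>_. ennreal (\<bar>R\<bar> ^ DIM('a \<times> 'a))))"
    using lborel_affine[of R ?t] R by simp
  also have "\<dots> = (\<integral>\<^sup>+ z. ennreal (R ^ (2 * DIM('a))) * ?I ?f (?t + R *\<^sub>R z) \<partial>lborel)"
    using R by (subst nn_integral_density) (auto simp: nn_integral_distr mult_2)
  also have "\<dots> = (\<integral>\<^sup>+ z. ennreal (R powr (real DIM('a) - s * p)) * ?I f z \<partial>lborel)"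
  proof (rule nn_integral_cong)
    fix z :: "'a \<times> 'a"
    \<comment> \<open>The translation \<open>?t\<close> is chosen such that the substitution undoes
      the affine map in both components.\<close>
    have shift: "a + (1 / R) *\<^sub>R (- R *\<^sub>R a + R *\<^sub>R y) = y" for y
      using R by (simp add: algebra_simps)
    have "norm (fst (?t + R *\<^sub>R z) - snd (?t + R *\<^sub>R z)) = R * norm (fst z - snd z)"
      using R by (simp flip: scaleR_diff_right)
    then have "norm (fst (?t + R *\<^sub>R z) - snd (?t + R *\<^sub>R z)) powr ?q
        = R powr ?q * norm (fst z - snd z) powr ?q"
      using R by (simp add: powr_mult)
    moreover have "R ^ (2 * DIM('a)) / R powr ?q = R powr (real DIM('a) - s * p)"
      using R by (simp add: powr_realpow[symmetric] powr_diff[symmetric])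
    then have "R ^ (2 * DIM('a)) / (R powr ?q * X) = R powr (real DIM('a) - s * p) / X" for X
      by (simp only: flip: divide_divide_eq_left)
    ultimately show "ennreal (R ^ (2 * DIM('a))) * ?I ?f (?t + R *\<^sub>R z)
        = ennreal (R powr (real DIM('a) - s * p)) * ?I f z"
      using R shift by (simp flip: ennreal_mult'' times_divide_eq_left)
  qed
  also have "\<dots> = ennreal (R powr (real DIM('a) - s * p)) * gagliardo_pow s p f"
    by (subst nn_integral_cmult) (auto simp: gagliardo_pow_def lborel_prod)
  finally show ?thesis .
qed

lemma gagliardo_pow_scale:
  fixes f :: "'a::euclidean_space \<Rightarrow> real"
  assumes "continuous_on UNIV f"
  shows "gagliardo_pow s p (\<lambda>x. c * f x) = ennreal (\<bar>c\<bar> powr p) * gagliardo_pow s p f"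
proof -
  have [measurable]: "f \<in> borel_measurable borel"
    using assms by (rule borel_measurable_continuous_onI)
  have "\<bar>c * f x - c * f y\<bar> powr p = \<bar>c\<bar> powr p * \<bar>f x - f y\<bar> powr p" for x y
    by (simp add: abs_mult powr_mult flip: right_diff_distrib)
  then show ?thesis
    unfolding gagliardo_pow_def
    by (subst nn_integral_cmult[symmetric])
      (auto simp: ennreal_mult'[symmetric])
qed

text \<open>Jensen's inequality for the probability density \<^term>\<open>k\<close>, then Tonelli and translation
  invariance of the Gagliardo energy.\<close>
lemma gagliardo_pow_convolution_le:
  fixes w k :: "'a::euclidean_space \<Rightarrow> real"
  assumes p: "1 < p" and w: "continuous_on UNIV w" and k: "continuous_on UNIV k"
    and supp: "compact K" "\<And>z. z \<notin> K \<Longrightarrow> k z = 0"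
    and nonneg: "\<And>z. 0 \<le> k z" and mass: "(\<integral>z. k z \<partial>lborel) = 1"
  shows "gagliardo_pow s p (\<lambda>x. \<integral>z. w (x - z) * k z \<partial>lborel) \<le> gagliardo_pow s p w"
proof -
  let ?q = "real DIM('a) + s * p"
  let ?J = "\<lambda>x y z. \<bar>w (x - z) - w (y - z)\<bar> powr p / norm (x - y) powr ?q"
  have [measurable]: "w \<in> borel_measurable borel" "k \<in> borel_measurable borel"
    using w k by (auto intro: borel_measurable_continuous_onI)
  have cw: "continuous_on UNIV (\<lambda>z. w (x - z))" for x
    by (intro continuous_on_compose2[OF w] continuous_intros) simp
  have int_w: "integrable lborel (\<lambda>z. w (x - z) * k z)" for x
    by (rule integrable_continuous_compact_support[OF _ supp(1)])
      (auto simp: supp intro!: continuous_intros cw k)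
  have int_k: "integrable lborel k"
    by (rule integrable_continuous_compact_support[OF k supp])
  have "gagliardo_pow s p (\<lambda>x. \<integral>z. w (x - z) * k z \<partial>lborel)
      \<le> (\<integral>\<^sup>+ v. (\<integral>\<^sup>+ z. ennreal (k z * ?J (fst v) (snd v) z) \<partial>lborel) \<partial>(lborel \<Otimes>\<^sub>M lborel))"
    unfolding gagliardo_pow_def
  proof (rule nn_integral_mono)
    fix v :: "'a \<times> 'a"
    obtain x y where v: "v = (x, y)" by (cases v)
    let ?g = "\<lambda>z. w (x - z) - w (y - z)"
    have int_g: "integrable lborel (\<lambda>z. ?g z * k z)"
      using int_w by (simp add: left_diff_distrib)
    have int_gp: "integrable lborel (\<lambda>z. \<bar>?g z\<bar> powr p * k z)"
      using p by (intro integrable_continuous_compact_support[OF _ supp(1)])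
        (auto simp: supp intro!: continuous_intros cw k continuous_on_powr')
    have "(\<integral>z. w (x - z) * k z \<partial>lborel) - (\<integral>z. w (y - z) * k z \<partial>lborel) = (\<integral>z. ?g z * k z \<partial>lborel)"
      using int_w by (simp add: left_diff_distrib)
    then have "\<bar>(\<integral>z. w (x - z) * k z \<partial>lborel) - (\<integral>z. w (y - z) * k z \<partial>lborel)\<bar> powr p
        / norm (x - y) powr ?q \<le> (\<integral>z. \<bar>?g z\<bar> powr p * k z \<partial>lborel) / norm (x - y) powr ?q"
      using jensen_powr[OF p nonneg int_k mass int_g int_gp] by (auto intro: divide_right_mono)
    \<comment> \<open>The diagonal \<open>x = y\<close> needs no exception: the denominator is
      \<open>0\<close> there, and a quotient by \<open>0\<close> is \<open>0\<close>.\<close>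
    also have "\<dots> = (\<integral>z. k z * ?J x y z \<partial>lborel)"
      by (subst integral_divide_zero[symmetric]) (simp add: mult.commute)
    finally have "ennreal (\<bar>(\<integral>z. w (x - z) * k z \<partial>lborel) - (\<integral>z. w (y - z) * k z \<partial>lborel)\<bar> powr p
        / norm (x - y) powr ?q) \<le> ennreal (\<integral>z. k z * ?J x y z \<partial>lborel)"
      by (rule ennreal_leI)
    also have "\<dots> = (\<integral>\<^sup>+ z. ennreal (k z * ?J x y z) \<partial>lborel)"
    proof (rule nn_integral_eq_integral[symmetric])
      show "integrable lborel (\<lambda>z. k z * ?J x y z)"
        using integrable_divide_zero[OF int_gp, of "norm (x - y) powr ?q"]
        by (simp add: mult.commute)
    qed (use nonneg in auto)
    finally show "ennreal (\<bar>(\<integral>z. w (fst v - z) * k z \<partial>lborel) - (\<integral>z. w (snd v - z) * k z \<partial>lborel)\<bar> powr p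
        / norm (fst v - snd v) powr ?q) \<le> (\<integral>\<^sup>+ z. ennreal (k z * ?J (fst v) (snd v) z) \<partial>lborel)"
      by (simp add: v)
  qed
  also have "\<dots> = (\<integral>\<^sup>+ z. (\<integral>\<^sup>+ v. ennreal (k z * ?J (fst v) (snd v) z) \<partial>(lborel \<Otimes>\<^sub>M lborel)) \<partial>lborel)"
    unfolding lborel_prod
    by (rule lborel_pair.Fubini'[symmetric]) (simp add: lborel_prod case_prod_unfold flip: borel_prod)
  also have "\<dots> = (\<integral>\<^sup>+ z. ennreal (k z) * gagliardo_pow s p w \<partial>lborel)"
  proof (rule nn_integral_cong)
    fix z
    have "gagliardo_pow s p (\<lambda>x. w (x - z)) = gagliardo_pow s p w"
      using gagliardo_pow_affine[OF w, of 1 s p "- z"] by simp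
    moreover have "(\<integral>\<^sup>+ v. ennreal (k z * ?J (fst v) (snd v) z) \<partial>(lborel \<Otimes>\<^sub>M lborel))
        = ennreal (k z) * gagliardo_pow s p (\<lambda>x. w (x - z))"
      unfolding gagliardo_pow_def using nonneg
      by (subst nn_integral_cmult[symmetric]) (auto simp: ennreal_mult[symmetric])
    ultimately show "(\<integral>\<^sup>+ v. ennreal (k z * ?J (fst v) (snd v) z) \<partial>(lborel \<Otimes>\<^sub>M lborel))
        = ennreal (k z) * gagliardo_pow s p w"
      by simp
  qed
  also have "\<dots> = gagliardo_pow s p w"
    using nn_integral_eq_integral[OF int_k] nonneg mass by (simp add: nn_integral_multc)
  finally show ?thesis .
qed

section \<open>Hoelder quotients and their supremum\<close>

text \<open>The form without a quotient also holds on the diagonal, where both sides are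
  \<open>0\<close>, and passes directly to sums and averages.\<close>

lemma bdd_above_holder_quots_iff:
  "bdd_above (holder_quots \<alpha> f) \<longleftrightarrow> (\<exists>L. \<forall>x y. \<bar>f x - f y\<bar> \<le> L * norm (x - y) powr \<alpha>)"
proof
  assume "bdd_above (holder_quots \<alpha> f)"
  then obtain L where L: "\<bar>f x - f y\<bar> / norm (x - y) powr \<alpha> \<le> L" if "x \<noteq> y" for x y
    unfolding bdd_above_def holder_quots_def by blast
  have "\<bar>f x - f y\<bar> \<le> L * norm (x - y) powr \<alpha>" for x y
    using L[of x y] by (cases "x = y") (auto simp: pos_divide_le_eq)
  then show "\<exists>L. \<forall>x y. \<bar>f x - f y\<bar> \<le> L * norm (x - y) powr \<alpha>" by blast
next
  assume "\<exists>L. \<forall>x y. \<bar>f x - f y\<bar> \<le> L * norm (x - y) powr \<alpha>"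
  then obtain L where "\<bar>f x - f y\<bar> \<le> L * norm (x - y) powr \<alpha>" for x y by blast
  then show "bdd_above (holder_quots \<alpha> f)"
    by (intro bdd_aboveI[of _ L]) (auto simp: holder_quots_def pos_divide_le_eq)
qed

lemma holder_quot_le_seminorm:
  "bdd_above (holder_quots \<alpha> f) \<Longrightarrow> x \<noteq> y \<Longrightarrow>
    \<bar>f x - f y\<bar> / norm (x - y) powr \<alpha> \<le> holder_seminorm \<alpha> f"
  unfolding holder_seminorm_def by (rule cSup_upper) (auto simp: holder_quots_def)

lemma holder_seminorm_le:
  fixes f :: "'a::euclidean_space \<Rightarrow> real"
  assumes "\<And>x y. x \<noteq> y \<Longrightarrow> \<bar>f x - f y\<bar> / norm (x - y) powr \<alpha> \<le> S"
  shows "holder_seminorm \<alpha> f \<le> S"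
  unfolding holder_seminorm_def
proof (rule cSup_least)
  \<comment> \<open>The supremum is taken over a nonempty set: \<open>0\<close> and a basis vector
    are two distinct points.\<close>
  obtain b :: 'a where "b \<in> Basis" using nonempty_Basis by blast
  then have "b \<noteq> 0" by auto
  then show "holder_quots \<alpha> f \<noteq> {}" unfolding holder_quots_def by blast
qed (use assms in \<open>auto simp: holder_quots_def\<close>)

lemma holder_seminorm_scale:
  fixes f :: "'a::euclidean_space \<Rightarrow> real"
  assumes f: "bdd_above (holder_quots \<alpha> f)" and c: "0 < c"
  shows "bdd_above (holder_quots \<alpha> (\<lambda>x. c * f x))"
    and "holder_seminorm \<alpha> (\<lambda>x. c * f x) = c * holder_seminorm \<alpha> f"
proof -
  have eq: "\<bar>c * f x - c * f y\<bar> = c * \<bar>f x - f y\<bar>" for x y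
    using c by (simp add: abs_mult flip: right_diff_distrib)
  obtain L where "\<bar>f x - f y\<bar> \<le> L * norm (x - y) powr \<alpha>" for x y
    using f bdd_above_holder_quots_iff by metis
  then have "\<bar>c * f x - c * f y\<bar> \<le> (c * L) * norm (x - y) powr \<alpha>" for x y
    using c unfolding eq by (simp add: mult.assoc)
  then show bdd: "bdd_above (holder_quots \<alpha> (\<lambda>x. c * f x))"
    unfolding bdd_above_holder_quots_iff by blast
  show "holder_seminorm \<alpha> (\<lambda>x. c * f x) = c * holder_seminorm \<alpha> f"
  proof (rule antisym)
    show "holder_seminorm \<alpha> (\<lambda>x. c * f x) \<le> c * holder_seminorm \<alpha> f"
      using c holder_quot_le_seminorm[OF f]
      by (intro holder_seminorm_le) (simp add: eq mult_left_mono flip: times_divide_eq_right)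
    have "holder_seminorm \<alpha> f \<le> holder_seminorm \<alpha> (\<lambda>x. c * f x) / c"
      using c holder_quot_le_seminorm[OF bdd] unfolding eq
      by (intro holder_seminorm_le) (simp add: pos_le_divide_eq mult.commute)
    then show "c * holder_seminorm \<alpha> f \<le> holder_seminorm \<alpha> (\<lambda>x. c * f x)"
      using c by (simp add: pos_le_divide_eq mult.commute)
  qed
qed

section \<open>Test functions and mollification\<close>

lemma Cinf0_iff: "f \<in> Cinf0 \<longleftrightarrow> smooth f \<and> (\<exists>B. \<forall>x. B < norm x \<longrightarrow> f x = 0)"
proof -
  have "compact (closure {x. f x \<noteq> 0}) \<longleftrightarrow> bounded {x. f x \<noteq> 0}"
    by (metis bounded_closure bounded_subset closed_closure closure_subset compact_eq_bounded_closed)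
  also have "\<dots> \<longleftrightarrow> (\<exists>B. \<forall>x. B < norm x \<longrightarrow> f x = 0)"
    unfolding bounded_iff by (auto simp: not_le[symmetric])
  finally show ?thesis by (simp add: Cinf0_def)
qed

text \<open>Both sides are homogeneous of degree \<open>p\<close> in \<open>f\<close>, and division
  by the seminorm turns \<open>f\<close> into a competitor in the infimum.\<close>

lemma msp_mult_seminorm_le_Cinf0:
  fixes f :: "'a::euclidean_space \<Rightarrow> real"
  assumes f: "f \<in> Cinf0" and bdd: "bdd_above (holder_quots (alpha_sp s p DIM('a)) f)"
    and S: "0 < holder_seminorm (alpha_sp s p DIM('a)) f"
  shows "msp s p TYPE('a) * ennreal (holder_seminorm (alpha_sp s p DIM('a)) f powr p)
    \<le> gagliardo_pow s p f"
proof -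
  let ?S = "holder_seminorm (alpha_sp s p DIM('a)) f"
  let ?g = "\<lambda>x. (1 / ?S) * f x"
  have sm: "smooth f" using f by (simp add: Cinf0_def)
  have "?g \<in> Cinf0"
    using f smooth_scale_affine[OF sm, of "1 / ?S" 0 1] unfolding Cinf0_iff by auto
  moreover note holder_seminorm_scale[OF bdd, of "1 / ?S"]
  ultimately have "msp s p TYPE('a) \<le> gagliardo_pow s p ?g"
    unfolding msp_def using S by (intro INF_lower) simp
  also have "\<dots> = ennreal ((1 / ?S) powr p) * gagliardo_pow s p f"
    using S gagliardo_pow_scale[OF smooth_continuous_on[OF sm], of s p "1 / ?S"] by simp
  finally have "msp s p TYPE('a) * ennreal (?S powr p)
      \<le> ennreal ((1 / ?S) powr p) * gagliardo_pow s p f * ennreal (?S powr p)"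
    by (rule mult_right_mono) simp
  also have "\<dots> = ennreal ((1 / ?S) powr p * ?S powr p) * gagliardo_pow s p f"
    by (simp add: ennreal_mult mult_ac)
  also have "(1 / ?S) powr p * ?S powr p = 1"
    using S by (simp flip: powr_mult)
  finally show ?thesis by simp
qed

text \<open>The square of \<open>\<phi>\<close> is nonnegative, contraction towards a point
  \<open>a\<close> with \<open>\<phi> a \<noteq> 0\<close> shrinks its support into a small ball
  around \<open>0\<close>, and division by the integral normalises the mass.\<close>

lemma mollifier_exists:
  fixes \<phi> :: "'a::euclidean_space \<Rightarrow> real"
  assumes \<phi>: "\<phi> \<in> Cinf0" "\<phi> a \<noteq> 0" and \<epsilon>: "0 < \<epsilon>"
  obtains k :: "'a \<Rightarrow> real" where "smooth k" "\<And>z. 0 \<le> k z" "(\<integral>z. k z \<partial>lborel) = 1"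
    "\<And>z. \<epsilon> < norm z \<Longrightarrow> k z = 0"
proof -
  have sm: "smooth \<phi>" using \<phi> by (simp add: Cinf0_def)
  obtain B where B: "\<And>x. B < norm x \<Longrightarrow> \<phi> x = 0" using \<phi> unfolding Cinf0_iff by blast
  \<comment> \<open>Large enough that \<open>norm z > \<epsilon>\<close> forces
    \<open>norm (a + r *\<^sub>R z) > \<bar>B\<bar>\<close>. The absolute value is there because
    \<open>B\<close> may be negative; the summand \<open>1\<close> makes \<open>r\<close>
    positive.\<close>
  define r where "r = (\<bar>B\<bar> + norm a + 1) / \<epsilon>"
  define h where "h = (\<lambda>z. \<phi> (a + r *\<^sub>R z) * \<phi> (a + r *\<^sub>R z))"
  have smh: "smooth h"
    unfolding h_def using smooth_scale_affine[OF sm, of 1 a r] by (intro smooth_mult) simp_all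
  have supp: "h z = 0" if "\<epsilon> < norm z" for z
  proof -
    have r: "0 < r" using \<epsilon> by (auto simp: r_def intro!: divide_pos_pos add_nonneg_pos)
    have "\<bar>B\<bar> + norm a < r * \<epsilon>" using \<epsilon> by (simp add: r_def)
    also have "\<dots> < r * norm z" using r that by simp
    also have "\<dots> = norm (r *\<^sub>R z)" using r by simp
    also have "\<dots> \<le> norm (a + r *\<^sub>R z) + norm a"
      using norm_triangle_ineq4[of "a + r *\<^sub>R z" a] by simp
    finally show ?thesis using B[of "a + r *\<^sub>R z"] by (simp add: h_def)
  qed
  have cont: "continuous_on UNIV h" by (rule smooth_continuous_on[OF smh])
  have int: "integrable lborel h"
    by (rule integrable_continuous_compact_support[OF cont compact_cball[of 0 \<epsilon>]])
      (simp add: supp)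
  have nonneg: "0 \<le> h z" for z by (simp add: h_def)
  define I where "I = (\<integral>z. h z \<partial>lborel)"
  \<comment> \<open>A zero integral would make \<open>h\<close> vanish almost everywhere, hence
    everywhere by continuity, whereas \<open>h 0\<close> is the square of
    \<open>\<phi> a\<close>.\<close>
  have "I \<noteq> 0"
  proof
    assume "I = 0"
    then have "AE z in lborel. h z = 0"
      using integral_nonneg_eq_0_iff_AE[OF int] nonneg by (simp add: I_def)
    then have "AE z in lebesgue. z \<in> {z. h z = 0}" by (auto intro: AE_completion)
    moreover have "closed {z. h z = 0}"
      using cont by (intro closed_Collect_eq continuous_intros)
    ultimately have "(0::'a) \<in> {z. h z = 0}" by (intro mem_closed_if_AE_lebesgue)
    then show False using \<phi>(2) by (simp add: h_def)
  qed
  moreover have "0 \<le> I" unfolding I_def using nonneg by simp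
  ultimately have I: "0 < I" by simp
  show ?thesis
  proof
    show "smooth (\<lambda>z. (1 / I) * h z)" using smooth_scale_affine[OF smh, of "1 / I" 0 1] by simp
    show "0 \<le> (1 / I) * h z" for z using I nonneg by simp
    show "(\<integral>z. (1 / I) * h z \<partial>lborel) = 1" using I by (simp add: I_def)
    show "(1 / I) * h z = 0" if "\<epsilon> < norm z" for z using supp[OF that] by simp
  qed
qed

text \<open>A mean with total weight one obeys any bound on the values that carry weight. Asking for
  the bound only where \<open>k\<close> is nonzero allows a small support to be exploited.\<close>

lemma abs_integral_density_le:
  fixes g k :: "'a \<Rightarrow> real"
  assumes "integrable M k" "(\<integral>z. k z \<partial>M) = 1" "\<And>z. 0 \<le> k z"
    and "integrable M (\<lambda>z. g z * k z)" "\<And>z. k z \<noteq> 0 \<Longrightarrow> \<bar>g z\<bar> \<le> C"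
  shows "\<bar>\<integral>z. g z * k z \<partial>M\<bar> \<le> C"
proof -
  have "\<bar>\<integral>z. g z * k z \<partial>M\<bar> \<le> (\<integral>z. \<bar>g z * k z\<bar> \<partial>M)" by (rule integral_abs_bound)
  also have "\<dots> \<le> (\<integral>z. C * k z \<partial>M)"
  proof (rule integral_mono)
    show "\<bar>g z * k z\<bar> \<le> C * k z" for z
      using assms(3)[of z] assms(5)[of z] by (cases "k z = 0") (auto simp: abs_mult mult_right_mono)
  qed (use assms in auto)
  finally show ?thesis using assms(2) by simp
qed

text \<open>\<open>f\<close> is a weighted mean of translates of \<open>w\<close>, all of which
  share the Hoelder bound and the energy of \<open>w\<close>. Only translations by at most
  \<open>\<epsilon>\<close> carry weight, which controls the distance to \<open>w\<close>.\<close>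

lemma mollification:
  fixes w k :: "'a::euclidean_space \<Rightarrow> real"
  assumes p: "1 < p" and \<alpha>: "0 < \<alpha>"
    and w: "continuous_on UNIV w" "\<And>x. B < norm x \<Longrightarrow> w x = 0"
      "\<And>x y. \<bar>w x - w y\<bar> \<le> L * norm (x - y) powr \<alpha>"
    and L: "0 \<le> L"
    and k: "smooth k" "\<And>z. 0 \<le> k z" "(\<integral>z. k z \<partial>lborel) = 1" "\<And>z. \<epsilon> < norm z \<Longrightarrow> k z = 0"
  defines "f \<equiv> \<lambda>x. \<integral>z. w (x - z) * k z \<partial>lborel"
  shows "f \<in> Cinf0"
    and "\<bar>f x - f y\<bar> \<le> L * norm (x - y) powr \<alpha>"
    and "gagliardo_pow s p f \<le> gagliardo_pow s p w"
    and "\<bar>f x - w x\<bar> \<le> L * \<epsilon> powr \<alpha>"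
proof -
  have ck: "continuous_on UNIV k" by (rule smooth_continuous_on[OF k(1)])
  have supp: "k z = 0" if "z \<notin> cball 0 \<epsilon>" for z using that k(4) by simp
  have [measurable]: "w \<in> borel_measurable borel" "k \<in> borel_measurable borel"
    using w(1) ck by (auto intro: borel_measurable_continuous_onI)
  have int_k: "integrable lborel k"
    by (rule integrable_continuous_compact_support[OF ck compact_cball supp])
  have int_w: "integrable lborel (\<lambda>z. w (x - z) * k z)" for x
    by (rule integrable_continuous_compact_support[OF _ compact_cball[of 0 \<epsilon>]])
      (auto simp: k(4) intro!: continuous_intros ck continuous_on_compose2[OF w(1)])
  note average = abs_integral_density_le[OF int_k k(3) k(2)]
  show "\<bar>f x - f y\<bar> \<le> L * norm (x - y) powr \<alpha>" for x y
  proof -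
    have "f x - f y = (\<integral>z. (w (x - z) - w (y - z)) * k z \<partial>lborel)"
      unfolding f_def using int_w by (simp add: left_diff_distrib)
    moreover have "\<bar>w (x - z) - w (y - z)\<bar> \<le> L * norm (x - y) powr \<alpha>" for z
      using w(3)[of "x - z" "y - z"] by simp
    moreover have "integrable lborel (\<lambda>z. (w (x - z) - w (y - z)) * k z)"
      using int_w by (simp add: left_diff_distrib)
    ultimately show ?thesis by (simp only: average)
  qed
  show "\<bar>f x - w x\<bar> \<le> L * \<epsilon> powr \<alpha>" for x
  proof -
    have eq: "f x - w x = (\<integral>z. (w (x - z) - w x) * k z \<partial>lborel)"
      unfolding f_def using int_w int_k k(3) by (simp add: left_diff_distrib)
    have le: "\<bar>w (x - z) - w x\<bar> \<le> L * \<epsilon> powr \<alpha>" if "k z \<noteq> 0" for z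
    proof -
      have "norm z \<le> \<epsilon>" using k(4)[of z] that by linarith
      then have "norm z powr \<alpha> \<le> \<epsilon> powr \<alpha>" using \<alpha> by (intro powr_mono2) auto
      then have "L * norm z powr \<alpha> \<le> L * \<epsilon> powr \<alpha>" using L by (rule mult_left_mono)
      then show ?thesis using w(3)[of "x - z" x] by simp
    qed
    have "integrable lborel (\<lambda>z. (w (x - z) - w x) * k z)"
      using int_w int_k by (simp add: left_diff_distrib)
    then show ?thesis unfolding eq using le by (rule average)
  qed
  show "gagliardo_pow s p f \<le> gagliardo_pow s p w"
    unfolding f_def
    by (rule gagliardo_pow_convolution_le[OF p w(1) ck compact_cball supp k(2,3)])
  obtain c where c: "cball 0 B \<subseteq> cbox (- c) (c::'a)"
    using bounded_subset_cbox_symmetric[OF bounded_cball] by blast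
  \<comment> \<open>Reflection of the variable moves \<open>x\<close> into \<open>k\<close>. As
    \<open>w\<close> vanishes outside a ball, the domain becomes a box independent of
    \<open>x\<close>, as differentiation under the integral requires.\<close>
  have "f x = integral (cbox (- c) c) (\<lambda>y. w y * k (x - y))" for x
  proof -
    have int: "integrable lborel (\<lambda>y. w y * k (x - y))"
      by (rule integrable_continuous_compact_support[OF _ compact_cball[of 0 B]])
        (auto simp: w(2) intro!: continuous_intros w(1) continuous_on_compose2[OF ck])
    have "f x = (\<integral>y. w y * k (x - y) \<partial>lborel)"
      unfolding f_def by (subst integral_reflect_translate[of _ x]) simp_all
    also have "\<dots> = integral UNIV (\<lambda>y. w y * k (x - y))" using integral_lborel[OF int] by simp
    also have "(\<lambda>y. w y * k (x - y)) = (\<lambda>y. if y \<in> cbox (- c) c then w y * k (x - y) else 0)"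
    proof
      show "w y * k (x - y) = (if y \<in> cbox (- c) c then w y * k (x - y) else 0)" for y
        using c w(2)[of y] by (cases "norm y \<le> B") auto
    qed
    finally show ?thesis by (simp add: Henstock_Kurzweil_Integration.integral_restrict_UNIV)
  qed
  then have "f = (\<lambda>x. integral (cbox (- c) c) (\<lambda>y. w y * k (x - y)))" by blast
  then have "smooth f" using smooth_convolution[OF k(1) w(1)] by simp
  moreover have "f x = 0" if "B + \<epsilon> < norm x" for x
  proof -
    \<comment> \<open>If \<open>norm z \<le> \<epsilon>\<close>, then
      \<open>norm (x - z) > B\<close>; so one of the factors vanishes.\<close>
    have "w (x - z) * k z = 0" for z
      using w(2)[of "x - z"] k(4)[of z] that norm_triangle_ineq2[of x z] by force
    then show ?thesis by (simp only: f_def) simp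
  qed
  ultimately show "f \<in> Cinf0" unfolding Cinf0_iff by blast
qed

section \<open>Approximation of bounded functions in energy\<close>

text \<open>The weighted power inequality under the integral. Only the differences of
  \<open>w\<close> are compared, because \<open>w\<close> will be a product with a cut-off and not a
  sum.\<close>

lemma gagliardo_pow_add_le:
  fixes f g w :: "'a::euclidean_space \<Rightarrow> real"
  assumes p: "1 < p" and t: "0 < t" "t < 1"
    and cont: "continuous_on UNIV f" "continuous_on UNIV g"
    and le: "\<And>x y. \<bar>w x - w y\<bar> \<le> \<bar>f x - f y\<bar> + \<bar>g x - g y\<bar>"
  shows "gagliardo_pow s p w \<le> ennreal ((1 - t) powr (1 - p)) * gagliardo_pow s p f
    + ennreal (t powr (1 - p)) * gagliardo_pow s p g"
proof -
  have [measurable]: "f \<in> borel_measurable borel" "g \<in> borel_measurable borel"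
    using cont by (auto intro: borel_measurable_continuous_onI)
  let ?q = "real DIM('a) + s * p"
  let ?I = "\<lambda>h z. \<bar>h (fst z) - h (snd z)\<bar> powr p / norm (fst z - snd z) powr ?q"
  have "gagliardo_pow s p w \<le> (\<integral>\<^sup>+ z. ennreal ((1 - t) powr (1 - p)) * ennreal (?I f z)
      + ennreal (t powr (1 - p)) * ennreal (?I g z) \<partial>(lborel \<Otimes>\<^sub>M lborel))"
    unfolding gagliardo_pow_def
  proof (rule nn_integral_mono)
    fix z :: "'a \<times> 'a"
    let ?a = "\<bar>f (fst z) - f (snd z)\<bar>" and ?b = "\<bar>g (fst z) - g (snd z)\<bar>"
    have "\<bar>w (fst z) - w (snd z)\<bar> powr p \<le> (?a + ?b) powr p"
      using p le by (intro powr_mono2) auto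
    also have "\<dots> \<le> (1 - t) powr (1 - p) * ?a powr p + t powr (1 - p) * ?b powr p"
      using p t by (intro powr_add_weighted) auto
    finally have "?I w z \<le> (1 - t) powr (1 - p) * ?I f z + t powr (1 - p) * ?I g z"
      by (simp add: divide_right_mono flip: add_divide_distrib)
    then show "ennreal (?I w z) \<le> ennreal ((1 - t) powr (1 - p)) * ennreal (?I f z)
        + ennreal (t powr (1 - p)) * ennreal (?I g z)"
      by (simp add: ennreal_leI flip: ennreal_mult ennreal_plus)
  qed
  also have "\<dots> = ennreal ((1 - t) powr (1 - p)) * gagliardo_pow s p f
      + ennreal (t powr (1 - p)) * gagliardo_pow s p g"
    unfolding gagliardo_pow_def by (simp add: nn_integral_add nn_integral_cmult)
  finally show ?thesis .
qed

text \<open>The maximum over a ball that contains the support is global. Division by the value at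
  \<open>a\<close> then gives a cut-off bounded by one.\<close>

lemma Cinf0_abs_attains_max:
  fixes \<phi> :: "'a::euclidean_space \<Rightarrow> real"
  assumes "\<phi> \<in> Cinf0"
  obtains a where "\<And>x. \<bar>\<phi> x\<bar> \<le> \<bar>\<phi> a\<bar>"
proof -
  obtain B where B: "\<And>x. B < norm x \<Longrightarrow> \<phi> x = 0" using assms unfolding Cinf0_iff by blast
  \<comment> \<open>The absolute value keeps the ball nonempty.\<close>
  have "continuous_on (cball 0 \<bar>B\<bar>) (\<lambda>x. \<bar>\<phi> x\<bar>)"
    using assms by (intro continuous_intros smooth_continuous_on) (simp add: Cinf0_def)
  then obtain a where a: "\<And>x. x \<in> cball 0 \<bar>B\<bar> \<Longrightarrow> \<bar>\<phi> x\<bar> \<le> \<bar>\<phi> a\<bar>"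
    using continuous_attains_sup[of "cball 0 \<bar>B\<bar>" "\<lambda>x. \<bar>\<phi> x\<bar>"] by fastforce
  have "\<bar>\<phi> x\<bar> \<le> \<bar>\<phi> a\<bar>" for x
    using a[of x] B[of x] by (cases "norm x \<le> \<bar>B\<bar>") auto
  then show ?thesis by (rule that)
qed

text \<open>Cut off with the dilates of \<^term>\<open>\<phi>\<close>, normalised to have maximum one, and mollify.
  Since \<open>s * p > N\<close>, the energy of the dilates tends to zero, so that for a bounded function
  the cut-off costs no energy in the limit.\<close>
lemma bounded_approximation_by_Cinf0:
  fixes v \<phi> :: "'a::euclidean_space \<Rightarrow> real"
  assumes p: "1 < p" and sp: "real DIM('a) < s * p" and \<alpha>: "0 < \<alpha>"
    and v: "continuous_on UNIV v" "\<And>x. \<bar>v x\<bar> \<le> M" "bdd_above (holder_quots \<alpha> v)"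
    and \<phi>: "\<phi> \<in> Cinf0" "bdd_above (holder_quots \<alpha> \<phi>)" "gagliardo_pow s p \<phi> < \<infinity>" "\<phi> b \<noteq> 0"
    and \<delta>: "0 < \<delta>"
  obtains f where "f \<in> Cinf0" "bdd_above (holder_quots \<alpha> f)"
    "gagliardo_pow s p f \<le> ennreal (1 + \<delta>) * gagliardo_pow s p v + ennreal \<delta>"
    "\<bar>f x0 - v x0\<bar> \<le> \<delta>" "\<bar>f y0 - v y0\<bar> \<le> \<delta>"
proof -
  obtain a where a: "\<And>x. \<bar>\<phi> x\<bar> \<le> \<bar>\<phi> a\<bar>" using Cinf0_abs_attains_max[OF \<phi>(1)] by blast
  have a0: "\<phi> a \<noteq> 0" using a[of b] \<phi>(4) by auto
  have sm: "smooth \<phi>" using \<phi>(1) by (simp add: Cinf0_def)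
  have c\<phi>: "continuous_on S \<phi>" for S by (rule smooth_continuous_on[OF sm])
  have M: "0 \<le> M" using v(2)[of 0] by linarith
  \<comment> \<open>Centred so that \<open>\<eta> R 0 = 1\<close>; at each point the value tends to
    one as \<open>R\<close> grows.\<close>
  define \<eta> where "\<eta> = (\<lambda>R x. \<phi> (a + (1 / R) *\<^sub>R x) / \<phi> a)"
  have \<eta>_le: "\<bar>\<eta> R x\<bar> \<le> 1" for R x using a a0 by (simp add: \<eta>_def)
  have c\<eta>: "continuous_on UNIV (\<eta> R)" for R
    unfolding \<eta>_def using a0
    by (intro continuous_intros continuous_on_compose2[OF c\<phi>[of UNIV]]) auto
  have \<eta>_lim: "((\<lambda>R. v x * \<eta> R x) \<longlongrightarrow> v x) at_top" for x
  proof -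
    have "((\<lambda>R::real. a + (1 / R) *\<^sub>R x) \<longlongrightarrow> a + 0 *\<^sub>R x) at_top"
      by (intro tendsto_intros tendsto_divide_0[OF tendsto_const] filterlim_at_top_imp_at_infinity
          filterlim_ident)
    then have "((\<lambda>R::real. \<phi> (a + (1 / R) *\<^sub>R x)) \<longlongrightarrow> \<phi> a) at_top"
      using c\<phi>[of UNIV] by (intro continuous_on_tendsto_compose[OF c\<phi>[of UNIV]]) auto
    then have "((\<lambda>R. v x * \<eta> R x) \<longlongrightarrow> v x * (\<phi> a / \<phi> a)) at_top"
      unfolding \<eta>_def using a0 by (intro tendsto_intros)
    then show ?thesis using a0 by simp
  qed
  \<comment> \<open>\<open>t\<close> is fixed first, to bring the factor of the energy of
    \<open>v\<close> below \<open>1 + \<delta>\<close>. The other factor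
    \<open>t powr (1 - p)\<close> may be huge, but it is a constant when \<open>R\<close> is
    chosen.\<close>
  have "((\<lambda>t. (1 - t) powr (1 - p)) \<longlongrightarrow> (1 - 0) powr (1 - p)) (at_right 0)"
    by (intro tendsto_intros) auto
  then have "\<forall>\<^sub>F t in at_right 0. (1 - t) powr (1 - p) < 1 + \<delta>"
    using \<delta> by (intro order_tendstoD) auto
  moreover have "\<forall>\<^sub>F t::real in at_right 0. 0 < t \<and> t < 1"
    using eventually_at_right_real[of 0 "1::real"] by simp
  ultimately have "\<forall>\<^sub>F t in at_right 0. (1 - t) powr (1 - p) < 1 + \<delta> \<and> 0 < t \<and> t < 1"
    by (rule eventually_conj)
  then obtain t where t: "(1 - t) powr (1 - p) < 1 + \<delta>" "0 < t" "t < 1"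
    using eventually_happens'[of "at_right (0::real)"] by auto
  define g where "g = enn2real (gagliardo_pow s p \<phi>)"
  have g: "gagliardo_pow s p \<phi> = ennreal g" using \<phi>(3) by (simp add: g_def less_top)
  have g0: "0 \<le> g" by (simp add: g_def)
  \<comment> \<open>The weighted energy of \<open>M * \<eta> R\<close>; it tends to zero because the
    exponent of \<open>R\<close> is negative.\<close>
  define Q where "Q = (\<lambda>R. t powr (1 - p) * ((M / \<bar>\<phi> a\<bar>) powr p * (R powr (real DIM('a) - s * p) * g)))"
  have "(Q \<longlongrightarrow> t powr (1 - p) * ((M / \<bar>\<phi> a\<bar>) powr p * (0 * g))) at_top"
    unfolding Q_def using sp
    by (intro tendsto_intros tendsto_neg_powr filterlim_ident) auto
  then have "\<forall>\<^sub>F R in at_top. Q R < \<delta>"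
    using \<delta> by (intro order_tendstoD) auto
  moreover have "\<forall>\<^sub>F R in at_top. dist (v x * \<eta> R x) (v x) < \<delta> / 2" for x
    using \<eta>_lim[of x] \<delta> by (intro tendstoD) auto
  note this[of x0] this[of y0]
  moreover have "\<forall>\<^sub>F R::real in at_top. 0 < R" by (rule eventually_gt_at_top)
  ultimately have "\<forall>\<^sub>F R in at_top. Q R < \<delta> \<and> dist (v x0 * \<eta> R x0) (v x0) < \<delta> / 2
      \<and> dist (v y0 * \<eta> R y0) (v y0) < \<delta> / 2 \<and> 0 < R"
    by eventually_elim auto
  then obtain R where R: "Q R < \<delta>" "dist (v x0 * \<eta> R x0) (v x0) < \<delta> / 2"
      "dist (v y0 * \<eta> R y0) (v y0) < \<delta> / 2" "0 < R"
    using eventually_happens'[of "at_top :: real filter"] by auto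
  define w where "w = (\<lambda>x. v x * \<eta> R x)"
  define h where "h = (\<lambda>x. (M / \<phi> a) * \<phi> (a + (1 / R) *\<^sub>R x))"
  have h: "h = (\<lambda>x. M * \<eta> R x)" by (simp add: h_def \<eta>_def)
  \<comment> \<open>The product rule for differences. The bound \<open>M\<close> on \<open>v\<close>
    enters here: it lets the variation of the cut-off be charged to \<open>h\<close> alone.\<close>
  have w_diff: "\<bar>w x - w y\<bar> \<le> \<bar>v x - v y\<bar> + \<bar>h x - h y\<bar>" for x y
  proof -
    have "w x - w y = (v x - v y) * \<eta> R x + v y * (\<eta> R x - \<eta> R y)"
      by (simp add: w_def algebra_simps)
    then have "\<bar>w x - w y\<bar> \<le> \<bar>v x - v y\<bar> * \<bar>\<eta> R x\<bar> + \<bar>v y\<bar> * \<bar>\<eta> R x - \<eta> R y\<bar>"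
      by (metis abs_mult abs_triangle_ineq)
    also have "\<dots> \<le> \<bar>v x - v y\<bar> * 1 + M * \<bar>\<eta> R x - \<eta> R y\<bar>"
      using \<eta>_le v(2) by (intro add_mono mult_left_mono mult_right_mono) auto
    also have "M * \<bar>\<eta> R x - \<eta> R y\<bar> = \<bar>h x - h y\<bar>"
      using M by (simp add: h abs_mult flip: right_diff_distrib)
    finally show ?thesis by simp
  qed
  have cw: "continuous_on UNIV w" unfolding w_def by (intro continuous_intros v c\<eta>)
  have ch: "continuous_on UNIV h" unfolding h by (intro continuous_intros c\<eta>)
  have Gh: "ennreal (t powr (1 - p)) * gagliardo_pow s p h = ennreal (Q R)"
  proof -
    have "continuous_on UNIV (\<lambda>x. \<phi> (a + (1 / R) *\<^sub>R x))"
      by (intro continuous_intros continuous_on_compose2[OF c\<phi>[of UNIV]]) auto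
    from gagliardo_pow_scale[OF this, of s p "M / \<phi> a"] show ?thesis
      using M gagliardo_pow_affine[OF c\<phi> R(4), of s p a]
      by (simp add: h_def Q_def g g0 ennreal_mult)
  qed
  have Gw: "gagliardo_pow s p w \<le> ennreal (1 + \<delta>) * gagliardo_pow s p v + ennreal \<delta>"
  proof -
    have "gagliardo_pow s p w \<le> ennreal ((1 - t) powr (1 - p)) * gagliardo_pow s p v
        + ennreal (t powr (1 - p)) * gagliardo_pow s p h"
      by (rule gagliardo_pow_add_le[OF p t(2,3) v(1) ch w_diff])
    also have "\<dots> \<le> ennreal (1 + \<delta>) * gagliardo_pow s p v + ennreal \<delta>"
      unfolding Gh using t(1) R(1) by (intro add_mono mult_right_mono ennreal_leI) auto
    finally show ?thesis .
  qed
  obtain Lv where Lv: "\<And>x y. \<bar>v x - v y\<bar> \<le> Lv * norm (x - y) powr \<alpha>"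
    using v(3) unfolding bdd_above_holder_quots_iff by blast
  obtain L\<phi> where L\<phi>: "\<And>x y. \<bar>\<phi> x - \<phi> y\<bar> \<le> L\<phi> * norm (x - y) powr \<alpha>"
    using \<phi>(2) unfolding bdd_above_holder_quots_iff by blast
  \<comment> \<open>The Hoelder constant of \<open>v\<close> plus that of the rescaled
    \<open>\<phi>\<close>; the absolute value provides the nonnegativity that
    \<open>mollification\<close> asks for.\<close>
  define L where "L = \<bar>Lv + M / \<bar>\<phi> a\<bar> * (L\<phi> * (1 / R) powr \<alpha>)\<bar>"
  have w_holder: "\<bar>w x - w y\<bar> \<le> L * norm (x - y) powr \<alpha>" for x y
  proof -
    have "\<bar>h x - h y\<bar> = M / \<bar>\<phi> a\<bar> * \<bar>\<phi> (a + (1 / R) *\<^sub>R x) - \<phi> (a + (1 / R) *\<^sub>R y)\<bar>"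
      unfolding h_def using M by (simp add: abs_mult flip: right_diff_distrib diff_divide_distrib)
    also have "\<dots> \<le> M / \<bar>\<phi> a\<bar> * (L\<phi> * norm ((1 / R) *\<^sub>R (x - y)) powr \<alpha>)"
      using L\<phi>[of "a + (1 / R) *\<^sub>R x" "a + (1 / R) *\<^sub>R y"] M
      by (intro mult_left_mono) (auto simp: scaleR_diff_right)
    also have "norm ((1 / R) *\<^sub>R (x - y)) powr \<alpha> = (1 / R) powr \<alpha> * norm (x - y) powr \<alpha>"
      using R(4) by (simp only: norm_scaleR powr_mult) simp
    finally have "\<bar>w x - w y\<bar> \<le> (Lv + M / \<bar>\<phi> a\<bar> * (L\<phi> * (1 / R) powr \<alpha>)) * norm (x - y) powr \<alpha>"
      using w_diff[of x y] Lv[of x y] by (simp add: algebra_simps)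
    also have "\<dots> \<le> L * norm (x - y) powr \<alpha>"
      unfolding L_def by (intro mult_right_mono abs_ge_self) simp
    finally show ?thesis .
  qed
  obtain B where B: "\<And>x. B < norm x \<Longrightarrow> \<phi> x = 0" using \<phi>(1) unfolding Cinf0_iff by blast
  have w_supp: "w x = 0" if "R * (B + norm a) < norm x" for x
  proof -
    have "B + norm a < norm ((1 / R) *\<^sub>R x)"
      using that R(4) by (simp add: field_simps)
    then have "B < norm (a + (1 / R) *\<^sub>R x)"
      using norm_triangle_ineq4[of "a + (1 / R) *\<^sub>R x" a] by simp
    then show ?thesis by (simp add: w_def \<eta>_def B)
  qed
  \<comment> \<open>The cut-off has used half of \<open>\<delta>\<close> at the two points;
    \<open>\<epsilon>\<close> is chosen to keep the mollification error below the other
    half.\<close>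
  have "((\<lambda>\<epsilon>. L * \<epsilon> powr \<alpha>) \<longlongrightarrow> L * 0) (at_right 0)"
    using \<alpha> by (intro tendsto_intros tendsto_zero_powrI) (auto simp: eventually_at_right_less
        intro: eventually_mono[OF eventually_at_right_less[of 0]])
  then have "\<forall>\<^sub>F \<epsilon> in at_right 0. L * \<epsilon> powr \<alpha> < \<delta> / 2"
    using \<delta> by (intro order_tendstoD) auto
  then have "\<forall>\<^sub>F \<epsilon> in at_right 0. L * \<epsilon> powr \<alpha> < \<delta> / 2 \<and> 0 < \<epsilon>"
    using eventually_at_right_less[of "0::real"] by (rule eventually_conj)
  then obtain \<epsilon> where \<epsilon>: "L * \<epsilon> powr \<alpha> < \<delta> / 2" "0 < \<epsilon>"
    using eventually_happens'[of "at_right (0::real)"] by auto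
  obtain k where k: "smooth k" "\<And>z. 0 \<le> k z" "(\<integral>z. k z \<partial>lborel) = 1"
      "\<And>z::'a. \<epsilon> < norm z \<Longrightarrow> k z = 0"
    using mollifier_exists[OF \<phi>(1) a0 \<epsilon>(2)] by blast
  define f where "f = (\<lambda>x. \<integral>z. w (x - z) * k z \<partial>lborel)"
  have L0: "0 \<le> L" by (simp add: L_def)
  have moll: "f \<in> Cinf0" "\<And>x y. \<bar>f x - f y\<bar> \<le> L * norm (x - y) powr \<alpha>"
      "gagliardo_pow s p f \<le> gagliardo_pow s p w" "\<And>x. \<bar>f x - w x\<bar> \<le> L * \<epsilon> powr \<alpha>"
    unfolding f_def
    by (rule mollification[OF p \<alpha> cw _ w_holder L0 k(1-3), of "R * (B + norm a)" \<epsilon>];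
        simp add: w_supp k(4))+
  show ?thesis
  proof
    show "f \<in> Cinf0" by (rule moll(1))
    show "bdd_above (holder_quots \<alpha> f)" unfolding bdd_above_holder_quots_iff using moll(2) by blast
    show "gagliardo_pow s p f \<le> ennreal (1 + \<delta>) * gagliardo_pow s p v + ennreal \<delta>"
      using moll(3) Gw by (rule order_trans)
    show "\<bar>f x0 - v x0\<bar> \<le> \<delta>" "\<bar>f y0 - v y0\<bar> \<le> \<delta>"
      using moll(4)[of x0] moll(4)[of y0] \<epsilon>(1) R(2,3) unfolding w_def dist_real_def by linarith+
  qed
qed

section \<open>Minimality tested with bounded functions\<close>

text \<open>The quotient at the single pair \<open>(x, y)\<close> survives the approximation by test
  functions, and it bounds their seminorms from below. The seminorm of \<open>v\<close> itself need
  not be approximated.\<close>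

lemma msp_mult_holder_quot_le:
  fixes v :: "'a::euclidean_space \<Rightarrow> real"
  assumes p: "1 < p" and sp: "real DIM('a) < s * p"
    and v: "continuous_on UNIV v" "\<And>x. \<bar>v x\<bar> \<le> M"
      "bdd_above (holder_quots (alpha_sp s p DIM('a)) v)"
    and finite: "msp s p TYPE('a) < \<infinity>"
    and xy: "x \<noteq> y"
  shows "msp s p TYPE('a) * ennreal ((\<bar>v x - v y\<bar> / norm (x - y) powr alpha_sp s p DIM('a)) powr p)
    \<le> gagliardo_pow s p v"
proof (cases "v x = v y \<or> gagliardo_pow s p v = \<infinity>")
  case True
  then show ?thesis by auto
next
  case False
  let ?\<alpha> = "alpha_sp s p DIM('a)"
  have \<alpha>: "0 < ?\<alpha>" using p sp by (simp add: alpha_sp_def field_simps)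
  obtain \<phi> :: "'a \<Rightarrow> real" where \<phi>: "\<phi> \<in> Cinf0" "bdd_above (holder_quots ?\<alpha> \<phi>)"
      "holder_seminorm ?\<alpha> \<phi> = 1" "gagliardo_pow s p \<phi> < \<infinity>"
    using finite unfolding msp_def INF_less_iff by auto
  have "\<exists>b. \<phi> b \<noteq> 0"
  proof (rule ccontr)
    assume "\<not> ?thesis"
    then have "holder_seminorm ?\<alpha> \<phi> \<le> 0" by (intro holder_seminorm_le) auto
    with \<phi>(3) show False by simp
  qed
  then obtain b where b: "\<phi> b \<noteq> 0" by blast
  \<comment> \<open>Infimum and energy are finite at this point, so the limit in
    \<open>\<delta>\<close> can be taken among the reals.\<close>
  define m g where "m = enn2real (msp s p TYPE('a))" and "g = enn2real (gagliardo_pow s p v)"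
  have m: "msp s p TYPE('a) = ennreal m" "0 \<le> m" using finite by (simp_all add: m_def less_top)
  have g: "gagliardo_pow s p v = ennreal g" "0 \<le> g" using False by (simp_all add: g_def less_top)
  define D d where "D = \<bar>v x - v y\<bar>" and "d = norm (x - y) powr ?\<alpha>"
  have D: "0 < D" using False by (simp add: D_def)
  have d: "0 < d" using xy by (simp add: d_def)
  \<comment> \<open>Each of the two values moves by at most \<open>\<delta>\<close>, so a difference
    of at least \<open>D - 2 * \<delta>\<close> remains; \<open>\<delta> < D / 2\<close> keeps it
    positive.\<close>
  have "m * ((D - 2 * \<delta>) / d) powr p \<le> (1 + \<delta>) * g + \<delta>" if \<delta>: "0 < \<delta>" "\<delta> < D / 2" for \<delta>
  proof -
    obtain f where f: "f \<in> Cinf0" "bdd_above (holder_quots ?\<alpha> f)"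
        "gagliardo_pow s p f \<le> ennreal (1 + \<delta>) * gagliardo_pow s p v + ennreal \<delta>"
        "\<bar>f x - v x\<bar> \<le> \<delta>" "\<bar>f y - v y\<bar> \<le> \<delta>"
      by (rule bounded_approximation_by_Cinf0[OF p sp \<alpha> v \<phi>(1,2,4) b \<delta>(1),
            where ?x0.0 = x and ?y0.0 = y])
    have "D - 2 * \<delta> \<le> \<bar>f x - f y\<bar>" using f(4,5) unfolding D_def by linarith
    then have "(D - 2 * \<delta>) / d \<le> \<bar>f x - f y\<bar> / d" using d by (simp add: divide_right_mono)
    also have "\<dots> \<le> holder_seminorm ?\<alpha> f"
      unfolding d_def by (rule holder_quot_le_seminorm[OF f(2) xy])
    finally have le: "(D - 2 * \<delta>) / d \<le> holder_seminorm ?\<alpha> f" .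
    have pos: "0 < (D - 2 * \<delta>) / d" using \<delta> d by simp
    have "ennreal (m * ((D - 2 * \<delta>) / d) powr p) \<le> ennreal (m * holder_seminorm ?\<alpha> f powr p)"
      using le pos p m(2) by (intro ennreal_leI mult_left_mono powr_mono2) auto
    also have "\<dots> = msp s p TYPE('a) * ennreal (holder_seminorm ?\<alpha> f powr p)"
      using m by (simp add: ennreal_mult)
    also have "\<dots> \<le> gagliardo_pow s p f"
      using le pos by (intro msp_mult_seminorm_le_Cinf0 f) linarith
    also have "\<dots> \<le> ennreal ((1 + \<delta>) * g + \<delta>)"
      using f(3) g \<delta> by (simp add: ennreal_mult)
    finally show ?thesis
      by (rule ennreal_le_iff[THEN iffD1, rotated]) (use g(2) \<delta> in simp)
  qed
  then have "\<forall>\<^sub>F \<delta> in at_right 0. m * ((D - 2 * \<delta>) / d) powr p \<le> (1 + \<delta>) * g + \<delta>"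
    using eventually_at_right_real[of 0 "D / 2"] D by (auto elim: eventually_mono)
  moreover have "((\<lambda>\<delta>. m * ((D - 2 * \<delta>) / d) powr p) \<longlongrightarrow> m * ((D - 2 * 0) / d) powr p) (at_right 0)"
    using D d by (intro tendsto_intros) auto
  moreover have "((\<lambda>\<delta>. (1 + \<delta>) * g + \<delta>) \<longlongrightarrow> (1 + 0) * g + 0) (at_right 0)"
    by (intro tendsto_intros)
  ultimately have "m * ((D - 2 * 0) / d) powr p \<le> (1 + 0) * g + 0"
    by (intro tendsto_le[of "at_right (0::real)"]) auto
  then have "m * (D / d) powr p \<le> g" by simp
  then have "ennreal (m * (D / d) powr p) \<le> ennreal g" by (rule ennreal_leI)
  then show ?thesis using m g(1) by (simp add: ennreal_mult D_def d_def)
qed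

section \<open>Equality of energies and truncation of the extremal\<close>

text \<open>Ordered integrands whose integrals are finite and equal agree almost everywhere. By
  continuity the set of pairs with the reverse inequality is closed, and a closed set of full
  measure is the whole space.\<close>

lemma gagliardo_integrand_eq:
  fixes u v :: "'a::euclidean_space \<Rightarrow> real"
  assumes p: "0 < p" and cont: "continuous_on UNIV u" "continuous_on UNIV v"
    and le: "\<And>x y. \<bar>v x - v y\<bar> \<le> \<bar>u x - u y\<bar>"
    and finite: "gagliardo_pow s p v < \<infinity>" and ge: "gagliardo_pow s p u \<le> gagliardo_pow s p v"
  shows "\<bar>v x - v y\<bar> = \<bar>u x - u y\<bar>"
proof -
  let ?q = "real DIM('a) + s * p"
  let ?I = "\<lambda>h z. ennreal (\<bar>h (fst z) - h (snd z)\<bar> powr p / norm (fst z - snd z) powr ?q)"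
  let ?C = "{z. \<bar>u (fst z) - u (snd z)\<bar> \<le> \<bar>v (fst z) - v (snd z)\<bar>}"
  have [measurable]: "u \<in> borel_measurable borel" "v \<in> borel_measurable borel"
    using cont by (auto intro: borel_measurable_continuous_onI)
  \<comment> \<open>Otherwise the integrands would differ on a set that is not null, and finiteness
    of the smaller integral would make the inequality of the energies strict.\<close>
  have "AE z in lborel \<Otimes>\<^sub>M lborel. ?I u z \<le> ?I v z"
  proof (rule ccontr)
    assume "\<not> ?thesis"
    then have "gagliardo_pow s p v < gagliardo_pow s p u"
      unfolding gagliardo_pow_def using finite p le
      by (intro nn_integral_less)
        (auto simp: gagliardo_pow_def intro!: AE_I2 ennreal_leI divide_right_mono powr_mono2)
    with ge show False by simp
  qed
  then have "AE z in lborel \<Otimes>\<^sub>M lborel. z \<in> ?C"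
  proof (rule eventually_mono)
    fix z :: "'a \<times> 'a"
    assume z: "?I u z \<le> ?I v z"
    show "z \<in> ?C"
    proof (cases "fst z = snd z")
      case False
      then have "\<bar>u (fst z) - u (snd z)\<bar> powr p \<le> \<bar>v (fst z) - v (snd z)\<bar> powr p"
        using z by (simp add: ennreal_le_iff divide_le_cancel)
      then show ?thesis using p powr_less_mono2[of p "\<bar>v (fst z) - v (snd z)\<bar>" "\<bar>u (fst z) - u (snd z)\<bar>"]
        by (auto simp: not_le[symmetric])
    qed simp
  qed
  then have "AE z in lebesgue. z \<in> ?C" unfolding lborel_prod by (rule AE_completion)
  moreover have "closed ?C"
    by (intro closed_Collect_le continuous_intros continuous_on_compose2[OF cont(1)]
        continuous_on_compose2[OF cont(2)]) auto
  ultimately have "(x, y) \<in> ?C" by (rule mem_closed_if_AE_lebesgue[rotated])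
  then show ?thesis using le[of x y] by simp
qed

theorem theorem7p7:
  fixes u :: "'a::euclidean_space \<Rightarrow> real" and s p :: real and x0 y0 :: 'a
  assumes "0 < s" "s < 1" "1 < p" "s * p > real DIM('a)"
    and "extremal s p u"
    and "x0 \<noteq> y0"
    and "holder_seminorm (alpha_sp s p DIM('a)) u
           = \<bar>u x0 - u y0\<bar> / norm (x0 - y0) powr (alpha_sp s p DIM('a))"
  shows "u \<in> borel_measurable lborel \<and> (\<exists>C. AE x in lborel. \<bar>u x\<bar> \<le> C)
         \<and> (\<forall>x. min (u x0) (u y0) \<le> u x \<and> u x \<le> max (u x0) (u y0))"
proof -
  let ?\<alpha> = "alpha_sp s p DIM('a)"
  note p = \<open>1 < p\<close>
  have "u \<in> Wsp s p" using assms(5) by (simp add: extremal_def)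
  then have u: "continuous_on UNIV u" "bdd_above (holder_quots ?\<alpha> u)" "gagliardo_pow s p u < \<infinity>"
    by (simp_all add: Wsp_def)
  obtain x1 y1 where "u x1 \<noteq> u y1" using assms(5) by (auto simp: extremal_def)
  then have "x1 \<noteq> y1" by auto
  then have "0 < \<bar>u x1 - u y1\<bar> / norm (x1 - y1) powr ?\<alpha>"
    using \<open>u x1 \<noteq> u y1\<close> by (intro divide_pos_pos) auto
  also have "\<dots> \<le> holder_seminorm ?\<alpha> u"
    using \<open>x1 \<noteq> y1\<close> by (intro holder_quot_le_seminorm u)
  finally have S: "0 < holder_seminorm ?\<alpha> u" .
  have energy: "gagliardo_pow s p u = msp s p TYPE('a) * ennreal (holder_seminorm ?\<alpha> u powr p)"
    using assms(5) by (simp add: extremal_def)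
  \<comment> \<open>An infinite infimum times a positive seminorm power would make the energy of
    \<open>u\<close> infinite.\<close>
  have finite: "msp s p TYPE('a) < \<infinity>"
  proof (rule ccontr)
    assume "\<not> ?thesis"
    then have "msp s p TYPE('a) = top" by (simp flip: less_top)
    then show False using u(3) S energy by (simp add: ennreal_top_mult)
  qed
  define lo hi where "lo = min (u x0) (u y0)" and "hi = max (u x0) (u y0)"
  have lo_hi: "lo \<le> hi" by (simp add: lo_def hi_def)
  define v where "v = (\<lambda>x. max lo (min hi (u x)))"
  have v_bounds: "lo \<le> v x" "v x \<le> hi" for x using lo_hi by (auto simp: v_def)
  have v_diff: "\<bar>v x - v y\<bar> \<le> \<bar>u x - u y\<bar>" for x y by (auto simp: v_def max_def min_def)
  have v_ends: "v x0 = u x0" "v y0 = u y0" by (auto simp: v_def lo_def hi_def)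
  have cv: "continuous_on UNIV v" unfolding v_def by (intro continuous_intros u)
  obtain L where "\<And>x y. \<bar>u x - u y\<bar> \<le> L * norm (x - y) powr ?\<alpha>"
    using u(2) unfolding bdd_above_holder_quots_iff by blast
  then have bv: "bdd_above (holder_quots ?\<alpha> v)"
    unfolding bdd_above_holder_quots_iff using v_diff by (meson order_trans)
  have v_abs: "\<bar>v x\<bar> \<le> \<bar>lo\<bar> + \<bar>hi\<bar>" for x using v_bounds[of x] by linarith
  \<comment> \<open>At \<open>(x0, y0)\<close> the quotient of \<open>v\<close> equals that of
    \<open>u\<close>, which is the full seminorm; so the lower bound for \<open>v\<close> is exactly
    the energy of the extremal.\<close>
  have ge: "gagliardo_pow s p u \<le> gagliardo_pow s p v"
    using msp_mult_holder_quot_le[OF p assms(4) cv v_abs bv finite assms(6)]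
    by (simp add: energy assms(7) v_ends)
  have "gagliardo_pow s p v \<le> gagliardo_pow s p u"
    unfolding gagliardo_pow_def using p v_diff
    by (intro nn_integral_mono ennreal_leI divide_right_mono powr_mono2) auto
  then have "gagliardo_pow s p v < \<infinity>" using u(3) by (rule order_le_less_trans)
  then have eq: "\<bar>v x - v y\<bar> = \<bar>u x - u y\<bar>" for x y
    using gagliardo_integrand_eq[OF _ u(1) cv v_diff _ ge] p by simp
  have bounds: "lo \<le> u x \<and> u x \<le> hi" for x
  proof (rule ccontr)
    assume "\<not> ?thesis"
    then consider "u x < lo" | "hi < u x" by linarith
    then show False
    proof cases
      case 1
      \<comment> \<open>\<open>z\<close> is \<open>x0\<close> or \<open>y0\<close>. Truncation sends
        both \<open>u x\<close> and \<open>u z\<close> to \<open>lo\<close>, so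
        \<open>v x = v z\<close> although \<open>u x\<close> and \<open>u z\<close> differ.\<close>
      obtain z where "u z = lo" by (metis lo_def min_def)
      then show False using 1 eq[of x z] lo_hi by (simp add: v_def)
    next
      case 2
      obtain z where "u z = hi" by (metis hi_def max_def)
      then show False using 2 eq[of x z] lo_hi by (simp add: v_def)
    qed
  qed
  have "\<bar>u x\<bar> \<le> \<bar>lo\<bar> + \<bar>hi\<bar>" for x using bounds[of x] by linarith
  then have "\<exists>C. AE x in lborel. \<bar>u x\<bar> \<le> C" by (intro exI[of _ "\<bar>lo\<bar> + \<bar>hi\<bar>"]) simp
  moreover have "u \<in> borel_measurable lborel"
    using borel_measurable_continuous_onI[OF u(1)] by simp
  ultimately show ?thesis using bounds unfolding lo_def hi_def by blast
qed

end
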